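(* Let $\mathcal{H}$ be a complex Hilbert space and let $A,B\in L(\mathcal{H})$. The following conditions are equivalent: (1) $A$ is below $B$ in the minus order, i.e. there exist $P,Q\in L(\mathcal{H})$ with $P^2=P$, $Q^2=Q$, $A=PB$ and $A^*=QB^*$; (2) there exist inner inverses $A^-$ of $A$ and $(A^* )^-$ of $A^*$ such that (i) $A^-A=A^-B$ and $AA^-x=BA^-x$ for every $x\in\mathcal{D}(A^-)$, and (ii) $(A^* )^-A^*=(A^* )^-B^*$ and $A^*(A^* )^-x=B^*(A^* )^-x$ for every $x\in\mathcal{D}((A^* )^-)$.
   Context: $L(\mathcal{H})$ is the algebra of bounded linear operators on $\mathcal{H}$ and $R(T)$ is the range of $T$. An inner inverse of $T\in L(\mathcal{H})$ is a (not necessarily bounded) linear operator $T^-:\mathcal{D}(T^-)\to\mathcal{H}$ defined on a dense linear subspace $\mathcal{D}(T^-)\subseteq\mathcal{H}$ with $R(T)\subseteq\mathcal{D}(T^-)$ and $TT^-T=T$. An equality such as $A^-A=A^-B$ includes the requirement $R(B)\subseteq\mathcal{D}(A^-)$ (and similarly for $(A^* )^-B^*$). *)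

theory Defs
  imports "HOL-Analysis.Analysis"
begin

text \<open>
  Complex Hilbert spaces. The underlying real Hilbert space structure (norm, topology,
  completeness, real inner product) is that of the library, tied to the complex structure by the
  axioms relating \<^term>\<open>scaleR\<close> and \<^term>\<open>inner\<close> to their complex counterparts. Positive
  definiteness of the complex inner product and \<open>norm x = sqrt (Re (cinner x x))\<close> are therefore
  inherited. The inner product is linear in its first argument.
\<close>

class complex_vector = real_vector +
  fixes scaleC :: "complex \<Rightarrow> 'a \<Rightarrow> 'a" (infixr "*\<^sub>C" 75)
  assumes scaleC_add_right: "c *\<^sub>C (x + y) = c *\<^sub>C x + c *\<^sub>C y"
    and scaleC_add_left: "(c + d) *\<^sub>C x = c *\<^sub>C x + d *\<^sub>C x"
    and scaleC_scaleC: "c *\<^sub>C d *\<^sub>C x = (c * d) *\<^sub>C x"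
    and scaleR_scaleC: "r *\<^sub>R x = complex_of_real r *\<^sub>C x"

class complex_inner = complex_vector + real_inner +
  fixes cinner :: "'a \<Rightarrow> 'a \<Rightarrow> complex"
  assumes cinner_commute: "cinner x y = cnj (cinner y x)"
    and cinner_add_left: "cinner (x + y) z = cinner x z + cinner y z"
    and cinner_scaleC_left: "cinner (c *\<^sub>C x) y = c * cinner x y"
    and inner_eq_Re_cinner: "inner x y = Re (cinner x y)"

class complex_hilbert_space = complex_inner + complete_space

instantiation complex :: complex_hilbert_space
begin

definition scaleC_complex :: "complex \<Rightarrow> complex \<Rightarrow> complex"
  where "scaleC_complex c z = c * z"

definition cinner_complex :: "complex \<Rightarrow> complex \<Rightarrow> complex"
  where "cinner_complex z w = z * cnj w"

instance
  by standard (simp_all add: scaleC_complex_def cinner_complex_def scaleR_conv_of_real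
      inner_complex_def algebra_simps)

end

definition bounded_clinear :: "('a::complex_inner \<Rightarrow> 'a) \<Rightarrow> bool"
  where "bounded_clinear T \<longleftrightarrow> bounded_linear T \<and> (\<forall>c x. T (c *\<^sub>C x) = c *\<^sub>C T x)"

text \<open>Only meaningful for \<^term>\<open>bounded_clinear T\<close> on a Hilbert space, where the adjoint exists.\<close>

definition cadjoint :: "('a::complex_inner \<Rightarrow> 'a) \<Rightarrow> 'a \<Rightarrow> 'a"
  where "cadjoint T = (THE T'. \<forall>x y. cinner (T x) y = cinner x (T' y))"

definition csubspace :: "'a::complex_vector set \<Rightarrow> bool"
  where "csubspace D \<longleftrightarrow>
    0 \<in> D \<and> (\<forall>x\<in>D. \<forall>y\<in>D. x + y \<in> D) \<and> (\<forall>c. \<forall>x\<in>D. c *\<^sub>C x \<in> D)"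

definition clinear_on :: "'a::complex_vector set \<Rightarrow> ('a \<Rightarrow> 'a) \<Rightarrow> bool"
  where "clinear_on D S \<longleftrightarrow>
    (\<forall>x\<in>D. \<forall>y\<in>D. S (x + y) = S x + S y) \<and> (\<forall>c. \<forall>x\<in>D. S (c *\<^sub>C x) = c *\<^sub>C S x)"

text \<open>
  An unbounded operator is represented by its domain \<open>D\<close> and a total function \<open>S\<close> of which only
  the values on \<open>D\<close> matter.
\<close>

definition inner_inverse :: "('a::complex_inner \<Rightarrow> 'a) \<Rightarrow> 'a set \<Rightarrow> ('a \<Rightarrow> 'a) \<Rightarrow> bool"
  where "inner_inverse T D S \<longleftrightarrow>
    csubspace D \<and> closure D = UNIV \<and> clinear_on D S \<and> range T \<subseteq> D \<and> T \<circ> S \<circ> T = T"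

definition minus_below :: "('a::complex_inner \<Rightarrow> 'a) \<Rightarrow> ('a \<Rightarrow> 'a) \<Rightarrow> bool"
  where "minus_below A B \<longleftrightarrow>
    (\<exists>P Q. bounded_clinear P \<and> bounded_clinear Q \<and> P \<circ> P = P \<and> Q \<circ> Q = Q \<and>
      A = P \<circ> B \<and> cadjoint A = Q \<circ> cadjoint B)"

text \<open>
  The relations between an inner inverse \<open>(D, S)\<close> of \<open>A\<close> and the operators \<open>A\<close>, \<open>B\<close>:
  \<open>S A = S B\<close>, which includes that the range of \<open>B\<close> lies in the domain of \<open>S\<close>, and \<open>A S = B S\<close> on
  the domain of \<open>S\<close>.
\<close>

definition inner_inverse_rel ::
    "('a::complex_inner \<Rightarrow> 'a) \<Rightarrow> ('a \<Rightarrow> 'a) \<Rightarrow> 'a set \<Rightarrow> ('a \<Rightarrow> 'a) \<Rightarrow> bool"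
  where "inner_inverse_rel A B D S \<longleftrightarrow>
    range B \<subseteq> D \<and> S \<circ> A = S \<circ> B \<and> (\<forall>x\<in>D. A (S x) = B (S x))"

end

theory Submission
  imports Defs
begin

text \<open>
  If \<open>S\<close> is an inner inverse of \<open>A\<close> with \<open>S A = S B\<close> and \<open>A S = B S\<close>, then \<open>A = A S A = B S A\<close>, so
  the range of \<open>A\<close> lies in that of \<open>B\<close> and Douglas' theorem gives a bounded \<open>X\<close> with \<open>A = B X\<close>.
  Applying \<open>A S\<close> to \<open>B X\<close> yields \<open>A = A X\<close>, that is \<open>B X = B X X\<close>, and \<open>X\<close> is idempotent because
  \<open>B\<close> is injective on the closure of the range of its adjoint, where \<open>X\<close> takes its values. The
  adjoint of \<open>X\<close> is the required \<open>Q\<close>, and \<open>P\<close> arises in the same way from the adjoints of \<open>A\<close> and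
  \<open>B\<close>. Conversely, inner inverses need not be bounded, so \<open>B\<close> has an everywhere defined linear
  inner inverse \<open>T\<close>, and \<open>T A T\<close> satisfies all relations.
\<close>

section \<open>Real Hilbert spaces\<close>

text \<open>A sequence in \<open>M\<close> minimising the distance to \<open>x\<close> is Cauchy by
  the parallelogram law. Its limit attains the distance, and a nearest point leaves a remainder
  orthogonal to \<open>M\<close>.\<close>

lemma closed_subspace_orthogonal_projection:
  fixes M :: "'a::{real_inner,complete_space} set"
  assumes "closed M" and sub: "subspace M"
  shows "\<exists>v\<in>M. \<forall>m\<in>M. inner (x - v) m = 0"
proof -
  define d where "d = infdist x M"
  have ne: "M \<noteq> {}"
    using sub subspace_0 by blast
  have d_le: "d \<le> dist x m" if "m \<in> M" for m
    unfolding d_def using that by (rule infdist_le)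
  have "\<exists>m\<in>M. dist x m ^ 2 < d ^ 2 + inverse (real (Suc n))" for n
  proof -
    have "d ^ 2 < d ^ 2 + inverse (real (Suc n))"
      by simp
    then have "d < sqrt (d ^ 2 + inverse (real (Suc n)))"
      by (simp add: real_less_rsqrt)
    then obtain m where "m \<in> M" "dist x m < sqrt (d ^ 2 + inverse (real (Suc n)))"
      unfolding d_def infdist_notempty[OF ne] by (auto simp: cINF_less_iff[OF ne])
    moreover from this(2) have "dist x m ^ 2 < sqrt (d ^ 2 + inverse (real (Suc n))) ^ 2"
      by (intro power_strict_mono) auto
    ultimately show ?thesis
      by (auto simp: add_nonneg_nonneg)
  qed
  then obtain m where mM: "\<And>n. m n \<in> M"
    and m: "\<And>n. dist x (m n) ^ 2 < d ^ 2 + inverse (real (Suc n))"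
    by metis
  \<comment> \<open>The midpoint of \<open>m i\<close> and \<open>m j\<close> lies in
    \<open>M\<close>, hence at distance at least \<open>d\<close> from \<open>x\<close>; the
    parallelogram identity then leaves only the two excesses over \<open>d ^ 2\<close>, each
    doubled.\<close>
  have par: "dist (m i) (m j) ^ 2 < 2 * inverse (real (Suc i)) + 2 * inverse (real (Suc j))" for i j
  proof -
    have "(1/2) *\<^sub>R (m i + m j) \<in> M"
      using sub mM by (simp add: subspace_add subspace_scale)
    then have "d ^ 2 \<le> dist x ((1/2) *\<^sub>R (m i + m j)) ^ 2"
      using d_le infdist_nonneg[of x M] by (intro power_mono) (auto simp: d_def)
    moreover have "dist (m i) (m j) ^ 2
        = 2 * dist x (m i) ^ 2 + 2 * dist x (m j) ^ 2 - 4 * dist x ((1/2) *\<^sub>R (m i + m j)) ^ 2"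
      unfolding dist_norm power2_norm_eq_inner
      by (simp add: inner_diff inner_add inner_commute algebra_simps)
    ultimately show ?thesis
      using m[of i] m[of j] by linarith
  qed
  have "Cauchy m"
  proof (rule metric_CauchyI)
    fix e :: real assume "e > 0"
    then obtain N where N: "inverse (real (Suc N)) < e ^ 2 / 4"
      using reals_Archimedean[of "e ^ 2 / 4"] by auto
    have "dist (m i) (m j) < e" if "i \<ge> N" "j \<ge> N" for i j
    proof -
      have "inverse (real (Suc i)) \<le> inverse (real (Suc N))"
        "inverse (real (Suc j)) \<le> inverse (real (Suc N))"
        using that by (auto intro!: le_imp_inverse_le)
      then have "dist (m i) (m j) ^ 2 < e ^ 2"
        using par[of i j] N by linarith
      then show ?thesis
        using \<open>e > 0\<close> by (simp add: power2_less_imp_less)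
    qed
    then show "\<exists>N. \<forall>i\<ge>N. \<forall>j\<ge>N. dist (m i) (m j) < e"
      by blast
  qed
  then obtain v where v: "m \<longlonglongrightarrow> v"
    using Cauchy_convergent convergentD by blast
  have "v \<in> M"
    using \<open>closed M\<close> mM v closed_sequentially by blast
  have "dist x v ^ 2 \<le> d ^ 2"
  proof (rule LIMSEQ_le)
    show "(\<lambda>n. dist x (m n) ^ 2) \<longlonglongrightarrow> dist x v ^ 2"
      using v by (intro tendsto_intros)
    show "(\<lambda>n. d ^ 2 + inverse (real (Suc n))) \<longlonglongrightarrow> d ^ 2"
      using LIMSEQ_inverse_real_of_nat_add .
    show "\<exists>N. \<forall>n\<ge>N. dist x (m n) ^ 2 \<le> d ^ 2 + inverse (real (Suc n))"
      using m less_imp_le by blast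
  qed
  have "inner (x - v) w = 0" if "w \<in> M" for w
  proof (cases "w = 0")
    case False
    \<comment> \<open>This \<open>t\<close> minimises the quadratic
      \<open>dist x (v + t *\<^sub>R w) ^ 2\<close>; the minimum would drop below
      \<open>d ^ 2\<close> unless the inner product vanished.\<close>
    define t where "t = inner (x - v) w / inner w w"
    have "v + t *\<^sub>R w \<in> M"
      using sub \<open>v \<in> M\<close> that by (simp add: subspace_add subspace_scale)
    then have "d ^ 2 \<le> dist x (v + t *\<^sub>R w) ^ 2"
      using d_le infdist_nonneg[of x M] by (intro power_mono) (auto simp: d_def)
    also have "dist x (v + t *\<^sub>R w) ^ 2 = dist x v ^ 2 - 2 * t * inner (x - v) w + t ^ 2 * inner w w"
      unfolding dist_norm power2_norm_eq_inner
      by (simp add: inner_diff inner_add inner_commute algebra_simps power2_eq_square)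
    also have "\<dots> = dist x v ^ 2 - inner (x - v) w ^ 2 / inner w w"
      using False by (simp add: t_def field_simps power2_eq_square)
    finally have "inner (x - v) w ^ 2 / inner w w \<le> 0"
      using \<open>dist x v ^ 2 \<le> d ^ 2\<close> by linarith
    then show ?thesis
      using False inner_gt_zero_iff[of w] by (auto simp: divide_le_0_iff simp del: inner_gt_zero_iff)
  qed simp
  with \<open>v \<in> M\<close> show ?thesis
    by blast
qed

text \<open>A vector \<open>w\<close> orthogonal to the kernel of \<open>f\<close> represents
  \<open>f\<close> up to scaling: subtracting \<open>(f x / f w) *\<^sub>R w\<close> from
  \<open>x\<close> lands in the kernel, and pairing with \<open>w\<close> gives the factor.\<close>

lemma riesz_representation_real:
  fixes f :: "'a::{real_inner,complete_space} \<Rightarrow> real"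
  assumes "bounded_linear f"
  obtains u where "\<And>x. f x = inner x u"
proof (cases "\<forall>x. f x = 0")
  case True
  then show ?thesis
    using that[of 0] by simp
next
  case False
  interpret f: bounded_linear f by fact
  from False obtain x0 where x0: "f x0 \<noteq> 0" by blast
  have "closed {x. f x = 0}"
    by (intro closed_Collect_eq continuous_intros f.continuous_on)
  moreover have "subspace {x. f x = 0}"
    by (auto simp: subspace_def f.zero f.add f.scaleR)
  ultimately obtain v where v: "f v = 0" "\<And>m. f m = 0 \<Longrightarrow> inner (x0 - v) m = 0"
    using closed_subspace_orthogonal_projection[of "{x. f x = 0}" x0] by auto
  define w where "w = x0 - v"
  have fw: "f w \<noteq> 0"
    using x0 v by (simp add: w_def f.diff)
  then have w0: "w \<noteq> 0"
    using f.zero by auto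
  show ?thesis
  proof
    fix x
    have "inner w (x - (f x / f w) *\<^sub>R w) = 0"
      unfolding w_def by (rule v(2)) (use fw in \<open>simp add: f.diff f.scaleR w_def\<close>)
    then show "f x = inner x ((f w / inner w w) *\<^sub>R w)"
      using fw w0 by (simp add: inner_diff inner_commute field_simps)
  qed
qed

text \<open>Riesz representation of each functional \<open>inner (T x) y\<close> in \<open>x\<close>
  gives \<open>T' y\<close>. Linearity follows from uniqueness of the representing vector, and the
  bound from evaluating at \<open>x = T' y\<close>.\<close>

lemma bounded_linear_adjoint_exists:
  fixes T :: "'a::{real_inner,complete_space} \<Rightarrow> 'b::real_inner"
  assumes "bounded_linear T"
  obtains T' where "bounded_linear T'" and "\<And>x y. inner (T x) y = inner x (T' y)"
proof -
  interpret T: bounded_linear T by fact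
  have "\<exists>u. \<forall>x. inner (T x) y = inner x u" for y
    using riesz_representation_real[OF bounded_linear_inner_left_comp[OF assms, of y]] by metis
  then obtain T' where T': "\<And>x y. inner (T x) y = inner x (T' y)"
    by metis
  obtain K where K: "K > 0" "\<And>x. norm (T x) \<le> norm x * K"
    using T.pos_bounded by auto
  have "bounded_linear T'"
  proof (rule bounded_linear_intro)
    show "T' (x + y) = T' x + T' y" for x y
      by (rule vector_eq_ldot[THEN iffD1]) (simp add: inner_add_right flip: T')
    show "T' (r *\<^sub>R x) = r *\<^sub>R T' x" for r x
      by (rule vector_eq_ldot[THEN iffD1]) (simp flip: T')
    show "norm (T' y) \<le> norm y * K" for y
    proof (cases "T' y = 0")
      case False
      have "norm (T' y) * norm (T' y) = inner (T (T' y)) y"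
        by (simp add: T' flip: power2_norm_eq_inner power2_eq_square)
      also have "\<dots> \<le> norm (T (T' y)) * norm y"
        by (rule norm_cauchy_schwarz)
      also have "\<dots> \<le> norm (T' y) * K * norm y"
        by (intro mult_right_mono K) auto
      finally show ?thesis
        using False by (simp add: mult.assoc mult.commute)
    qed (use K in simp)
  qed
  with T' show ?thesis
    using that by blast
qed

text \<open>The uniform boundedness principle for the functionals represented by \<open>F\<close>:
  the closed sets \<open>E n\<close> cover the space, so by Baire one of them contains a
  ball.\<close>

lemma pointwise_bounded_imp_bounded:
  fixes F :: "'a::{real_inner,complete_space} set"
  assumes pw: "\<And>x. \<exists>K. \<forall>f\<in>F. \<bar>inner x f\<bar> \<le> K"
  shows "bounded F"
proof -
  define E where "E n = {x. \<forall>f\<in>F. \<bar>inner x f\<bar> \<le> real n}" for n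
  have closed_E: "closed (E n)" for n
  proof -
    have "E n = (\<Inter>f\<in>F. {x. \<bar>inner x f\<bar> \<le> real n})"
      by (auto simp: E_def)
    moreover have "closed {x. \<bar>inner x f\<bar> \<le> real n}" for f :: 'a
      by (intro closed_Collect_le continuous_intros)
    ultimately show ?thesis
      by auto
  qed
  have "(\<Union>n. E n) = UNIV"
  proof -
    have "\<exists>n. x \<in> E n" for x
    proof -
      obtain K where "\<forall>f\<in>F. \<bar>inner x f\<bar> \<le> K" using pw by blast
      moreover obtain n where "K \<le> real n" using real_arch_simple by blast
      ultimately show ?thesis unfolding E_def by (blast intro: order_trans)
    qed
    then show ?thesis by blast
  qed
  then have "\<exists>n. interior (E n) \<noteq> {}"
    using Baire_category_alt[of euclidean "range E"] closed_E
    by (force simp: completely_metrizable_space_euclidean)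
  then obtain n a where "a \<in> interior (E n)" by blast
  then obtain e where e: "e > 0" "cball a e \<subseteq> E n"
    using mem_interior_cball by blast
  have "norm f \<le> 2 * real n / e" if "f \<in> F" for f
  proof (cases "f = 0")
    case False
    \<comment> \<open>Moving from the centre to the boundary of the ball in the direction of
      \<open>f\<close> changes the functional by exactly \<open>e * norm f\<close>, while both
      values are at most \<open>n\<close> in modulus.\<close>
    define y where "y = a + (e / norm f) *\<^sub>R f"
    have "y \<in> cball a e"
      using False e by (simp add: y_def dist_norm)
    moreover have "a \<in> cball a e"
      using e by simp
    ultimately have "\<bar>inner y f\<bar> \<le> real n" "\<bar>inner a f\<bar> \<le> real n"
      using e(2) that unfolding E_def by blast+
    moreover have "inner y f = inner a f + e * norm f"
      using False by (simp add: y_def inner_add_left power2_eq_square flip: power2_norm_eq_inner)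
    ultimately have "e * norm f \<le> 2 * real n"
      by linarith
    then show ?thesis
      using e by (simp add: field_simps)
  qed (use e in simp)
  then show ?thesis
    unfolding bounded_iff by blast
qed

section \<open>Complex Hilbert spaces\<close>

lemma vector_space_scaleC: "vector_space (scaleC :: complex \<Rightarrow> 'a::complex_vector \<Rightarrow> 'a)"
proof
  show "1 *\<^sub>C x = x" for x :: 'a
    using scaleR_scaleC[of 1 x] by simp
qed (simp_all add: scaleC_add_right scaleC_add_left scaleC_scaleC)

lemma cinner_scaleC_right: "cinner x (c *\<^sub>C y) = cnj c * cinner x y"
  unfolding cinner_commute[of x] by (simp add: cinner_scaleC_left)

text \<open>Recovers the imaginary part from the real inner product, so that real adjoints can be
  turned into complex ones.\<close>

lemma cinner_eq_inner: "cinner x y = Complex (inner x y) (- inner (\<i> *\<^sub>C x) y)"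
  by (simp add: complex_eq_iff inner_eq_Re_cinner cinner_scaleC_left)

lemma norm_scaleC:
  fixes x :: "'a::complex_inner"
  shows "norm (c *\<^sub>C x) = cmod c * norm x"
proof (rule power2_eq_imp_eq)
  have "(norm (c *\<^sub>C x))\<^sup>2 = Re ((c * cnj c) * cinner x x)"
    by (simp only: power2_norm_eq_inner inner_eq_Re_cinner cinner_scaleC_left cinner_scaleC_right
        mult_ac)
  also have "\<dots> = (cmod c)\<^sup>2 * Re (cinner x x)"
    by (simp flip: complex_norm_square)
  finally show "(norm (c *\<^sub>C x))\<^sup>2 = (cmod c * norm x)\<^sup>2"
    by (simp add: power_mult_distrib power2_norm_eq_inner inner_eq_Re_cinner)
qed auto

lemma bounded_linear_scaleC_right:
  "bounded_linear (\<lambda>x::'a::complex_inner. c *\<^sub>C x)"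
proof (rule bounded_linear_intro)
  show "c *\<^sub>C r *\<^sub>R x = r *\<^sub>R c *\<^sub>C x" for r and x :: 'a
    by (simp add: scaleR_scaleC scaleC_scaleC mult.commute)
  show "norm (c *\<^sub>C x) \<le> norm x * cmod c" for x :: 'a
    by (simp add: norm_scaleC)
qed (auto simp: scaleC_add_right norm_scaleC mult.commute)

lemma cinner_ext: "(\<And>x. cinner x y = cinner x z) \<Longrightarrow> y = z"
  by (rule vector_eq_ldot[THEN iffD1]) (simp add: inner_eq_Re_cinner)

lemma bounded_clinear_imp_bounded_linear: "bounded_clinear T \<Longrightarrow> bounded_linear T"
  by (simp add: bounded_clinear_def)

lemma bounded_clinear_scaleC: "bounded_clinear T \<Longrightarrow> T (c *\<^sub>C x) = c *\<^sub>C T x"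
  by (simp add: bounded_clinear_def)

context
  fixes T :: "'a::complex_hilbert_space \<Rightarrow> 'a"
  assumes T: "bounded_clinear T"
begin

lemma cadjoint_eqI:
  assumes "\<And>x y. cinner (T x) y = cinner x (T' y)"
  shows "cadjoint T = T'"
  unfolding cadjoint_def
proof (rule the_equality)
  fix U assume "\<forall>x y. cinner (T x) y = cinner x (U y)"
  then have "cinner x (U y) = cinner x (T' y)" for x y
    by (simp flip: assms)
  then show "U = T'"
    by (intro ext) (rule cinner_ext)
qed (use assms in blast)

lemma bounded_clinear_cadjoint: "bounded_clinear (cadjoint T)"
  and cinner_cadjoint: "cinner (T x) y = cinner x (cadjoint T y)"
proof -
  obtain T' where "bounded_linear T'" and T': "\<And>x y. inner (T x) y = inner x (T' y)"
    using bounded_linear_adjoint_exists[OF bounded_clinear_imp_bounded_linear[OF T]] by metis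
  \<comment> \<open>As \<open>T\<close> commutes with multiplication by \<open>\<i>\<close>, the
    real adjoint identity at \<open>x\<close> and at \<open>\<i> *\<^sub>C x\<close> gives the real
    and the imaginary part.\<close>
  have eq: "cinner (T x) y = cinner x (T' y)" for x y
    unfolding cinner_eq_inner by (simp add: T' flip: bounded_clinear_scaleC[OF T])
  then have ad: "cadjoint T = T'"
    by (rule cadjoint_eqI)
  have "T' (c *\<^sub>C x) = c *\<^sub>C T' x" for c x
    by (rule cinner_ext) (simp add: cinner_scaleC_right flip: eq)
  then show "bounded_clinear (cadjoint T)"
    using \<open>bounded_linear T'\<close> by (simp add: ad bounded_clinear_def)
  show "cinner (T x) y = cinner x (cadjoint T y)"
    by (simp add: ad eq)
qed

lemma inner_cadjoint: "inner (T x) y = inner x (cadjoint T y)"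
  by (simp add: inner_eq_Re_cinner cinner_cadjoint)

end

lemma cadjoint_cadjoint:
  fixes T :: "'a::complex_hilbert_space \<Rightarrow> 'a"
  assumes "bounded_clinear T"
  shows "cadjoint (cadjoint T) = T"
proof (rule cadjoint_eqI)
  show "cinner (cadjoint T x) y = cinner x (T y)" for x y
    using cinner_cadjoint[OF assms, of y x] by (metis cinner_commute)
qed (rule bounded_clinear_cadjoint[OF assms])

lemma bounded_clinear_comp:
  "bounded_clinear S \<Longrightarrow> bounded_clinear T \<Longrightarrow> bounded_clinear (S \<circ> T)"
  using bounded_linear_compose[of S T] by (auto simp: bounded_clinear_def comp_def)

lemma cadjoint_comp:
  fixes S T :: "'a::complex_hilbert_space \<Rightarrow> 'a"
  assumes "bounded_clinear S" and "bounded_clinear T"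
  shows "cadjoint (S \<circ> T) = cadjoint T \<circ> cadjoint S"
  by (rule cadjoint_eqI[OF bounded_clinear_comp[OF assms]]) (simp add: assms[THEN cinner_cadjoint])

section \<open>Douglas factorization\<close>

lemma subspace_closure:
  fixes S :: "'a::real_normed_vector set"
  assumes "subspace S"
  shows "subspace (closure S)"
  unfolding subspace_def
proof (intro conjI ballI allI)
  show "0 \<in> closure S"
    using assms closure_subset subspace_0 by blast
next
  fix x y assume "x \<in> closure S" "y \<in> closure S"
  then obtain f g where "\<And>n. f n \<in> S" "f \<longlonglongrightarrow> x" "\<And>n. g n \<in> S" "g \<longlonglongrightarrow> y"
    by (auto simp: closure_sequential)
  then show "x + y \<in> closure S"
    unfolding closure_sequential
    by (intro exI[of _ "\<lambda>n. f n + g n"]) (auto intro!: tendsto_add subspace_add assms)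
next
  fix c x assume "x \<in> closure S"
  then obtain f where "\<And>n. f n \<in> S" "f \<longlonglongrightarrow> x"
    by (auto simp: closure_sequential)
  then show "c *\<^sub>R x \<in> closure S"
    unfolding closure_sequential
    by (intro exI[of _ "\<lambda>n. c *\<^sub>R f n"]) (auto intro!: tendsto_scaleR subspace_scale assms)
qed

lemma subspace_closure_range:
  assumes "bounded_linear T"
  shows "subspace (closure (range T))"
  by (rule subspace_closure[OF linear_subspace_image[OF bounded_linear.linear[OF assms] subspace_UNIV]])

text \<open>By continuity the bound passes from \<open>range T\<close> to its closure, where it can
  be tested on \<open>u\<close> itself.\<close>

lemma inner_closure_range_bound:
  fixes u :: "'a::real_inner"
  assumes "u \<in> closure (range T)" and "\<And>z. inner u (T z) \<le> K * norm (T z)" and "K \<ge> 0"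
  shows "norm u \<le> K"
proof (cases "u = 0")
  case False
  have "closed {m. inner u m \<le> K * norm m}"
    by (intro closed_Collect_le continuous_intros)
  then have "closure (range T) \<subseteq> {m. inner u m \<le> K * norm m}"
    by (intro closure_minimal) (use assms(2) in auto)
  with assms(1) have "norm u * norm u \<le> K * norm u"
    by (auto simp flip: power2_norm_eq_inner power2_eq_square)
  then show ?thesis
    using False by simp
qed (use assms in simp)

context
  fixes B :: "'a::complex_hilbert_space \<Rightarrow> 'a"
  assumes B: "bounded_clinear B"
begin

text \<open>Such a \<open>u\<close> is orthogonal to the range of the adjoint, so the preceding
  bound applies with constant 0.\<close>

lemma closure_range_cadjoint_kernel:
  assumes "u \<in> closure (range (cadjoint B))" and "B u = 0"
  shows "u = 0"
proof -
  have "norm u \<le> 0"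
    using assms(1)
    by (rule inner_closure_range_bound) (simp_all add: assms(2) flip: inner_cadjoint[OF B])
  then show ?thesis by simp
qed

lemma closure_range_cadjoint_inj:
  assumes "u \<in> closure (range (cadjoint B))" and "v \<in> closure (range (cadjoint B))"
    and "B u = B v"
  shows "u = v"
proof -
  interpret bounded_linear B
    using B by (rule bounded_clinear_imp_bounded_linear)
  have "u - v \<in> closure (range (cadjoint B))"
    using assms subspace_closure_range subspace_diff
      bounded_clinear_imp_bounded_linear[OF bounded_clinear_cadjoint[OF B]] by blast
  with assms(3) show ?thesis
    using closure_range_cadjoint_kernel[of "u - v"] by (simp add: diff)
qed

text \<open>Project \<open>x\<close> onto the closed range of the adjoint: the remainder is
  orthogonal to that range and is therefore killed by \<open>B\<close>.\<close>

lemma range_in_closure_range_cadjoint: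
  obtains u where "u \<in> closure (range (cadjoint B))" and "B u = B x"
proof -
  interpret bounded_linear B
    using B by (rule bounded_clinear_imp_bounded_linear)
  have "subspace (closure (range (cadjoint B)))"
    by (intro subspace_closure_range bounded_clinear_imp_bounded_linear bounded_clinear_cadjoint B)
  then obtain u where u: "u \<in> closure (range (cadjoint B))"
      "\<forall>m\<in>closure (range (cadjoint B)). inner (x - u) m = 0"
    using closed_subspace_orthogonal_projection[OF closed_closure] by blast
  have "inner (B (x - u)) z = inner 0 z" for z
  proof -
    have "cadjoint B z \<in> closure (range (cadjoint B))"
      by (rule subsetD[OF closure_subset rangeI])
    with u(2) show ?thesis
      by (simp add: inner_cadjoint[OF B])
  qed
  then have "B (x - u) = 0"
    using vector_eq_rdot by blast
  with u(1) that show ?thesis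
    by (simp add: diff)
qed

lemma scaleC_closure_range:
  assumes "u \<in> closure (range B)"
  shows "c *\<^sub>C u \<in> closure (range B)"
proof -
  have "c *\<^sub>C B x \<in> closure (range B)" for x
    using rangeI[of B "c *\<^sub>C x"] closure_subset
    unfolding bounded_clinear_scaleC[OF B] by (rule subsetD[rotated])
  then have "(\<lambda>x. c *\<^sub>C x) ` range B \<subseteq> closure (range B)"
    by blast
  then have "(\<lambda>x. c *\<^sub>C x) ` closure (range B) \<subseteq> closure (range B)"
    by (rule image_closure_subset[OF linear_continuous_on[OF bounded_linear_scaleC_right] closed_closure])
  with assms show ?thesis by blast
qed

end

text \<open>\<open>X x\<close> is the unique solution \<open>u\<close> of \<open>B u = A x\<close>
  in the closure of the range of \<open>cadjoint B\<close>. Uniqueness makes \<open>X\<close>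
  linear; boundedness comes from majorizing \<open>cadjoint A\<close> by
  \<open>cadjoint B\<close>.\<close>

theorem douglas_factorization:
  fixes A B :: "'a::complex_hilbert_space \<Rightarrow> 'a"
  assumes A: "bounded_clinear A" and B: "bounded_clinear B" and "range A \<subseteq> range B"
  obtains X where "bounded_clinear X" and "A = B \<circ> X"
    and "range X \<subseteq> closure (range (cadjoint B))"
proof -
  interpret A: bounded_linear A
    using A by (rule bounded_clinear_imp_bounded_linear)
  interpret B: bounded_linear B
    using B by (rule bounded_clinear_imp_bounded_linear)
  interpret Ad: bounded_linear "cadjoint A"
    by (intro bounded_clinear_imp_bounded_linear bounded_clinear_cadjoint A)
  interpret Bd: bounded_linear "cadjoint B"
    by (intro bounded_clinear_imp_bounded_linear bounded_clinear_cadjoint B)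
  let ?M = "closure (range (cadjoint B))"
  have "\<exists>u\<in>?M. B u = A x" for x
  proof -
    obtain y where "A x = B y"
      using \<open>range A \<subseteq> range B\<close> by blast
    then show ?thesis
      using range_in_closure_range_cadjoint[OF B, of y] by metis
  qed
  then obtain X where XM: "\<And>x. X x \<in> ?M" and BX: "\<And>x. B (X x) = A x"
    by metis
  note sub = subspace_closure_range[OF Bd.bounded_linear_axioms]
  note inj = closure_range_cadjoint_inj[OF B]
  have inner_X: "inner x (cadjoint A z) = inner (X x) (cadjoint B z)" for x z
    by (simp add: BX flip: inner_cadjoint[OF A] inner_cadjoint[OF B])
  \<comment> \<open>Uniform boundedness applies as \<open>X\<close> bounds this set pointwise; \<open>X\<close> itself is not yet known to be
    bounded.\<close>
  let ?F = "{cadjoint A z |z. norm (cadjoint B z) \<le> 1}"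
  have "bounded ?F"
  proof (rule pointwise_bounded_imp_bounded)
    fix x
    have "\<bar>inner x (cadjoint A z)\<bar> \<le> norm (X x)" if "norm (cadjoint B z) \<le> 1" for z
      unfolding inner_X using Cauchy_Schwarz_ineq2[of "X x" "cadjoint B z"] that
      by (smt (verit) mult_left_le norm_ge_zero)
    then show "\<exists>K. \<forall>f\<in>?F. \<bar>inner x f\<bar> \<le> K" by blast
  qed
  then obtain C where C: "C > 0" "\<And>z. norm (cadjoint B z) \<le> 1 \<Longrightarrow> norm (cadjoint A z) \<le> C"
    unfolding bounded_pos by blast
  \<comment> \<open>If \<open>cadjoint B z\<close> vanishes, \<open>inner_X\<close> at
    \<open>x = cadjoint A z\<close> shows that \<open>cadjoint A z\<close> vanishes too; otherwise
    \<open>z\<close> is rescaled to make \<open>cadjoint B z\<close> a unit vector.\<close>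
  have majorized: "norm (cadjoint A z) \<le> C * norm (cadjoint B z)" for z
  proof (cases "cadjoint B z = 0")
    case True
    then have "inner (cadjoint A z) (cadjoint A z) = 0"
      by (simp add: inner_X)
    with True show ?thesis by simp
  next
    case False
    then show ?thesis
      using C(2)[of "inverse (norm (cadjoint B z)) *\<^sub>R z"]
      by (simp add: Ad.scaleR Bd.scaleR field_simps)
  qed
  have "bounded_linear X"
  proof (rule bounded_linear_intro)
    show "X (x + y) = X x + X y" for x y
      by (rule inj) (use sub XM in \<open>simp_all add: subspace_add B.add BX A.add\<close>)
    show "X (r *\<^sub>R x) = r *\<^sub>R X x" for r x
      by (rule inj) (use sub XM in \<open>simp_all add: subspace_scale B.scaleR BX A.scaleR\<close>)
    \<comment> \<open>Since \<open>X x\<close> lies in the closure of the range of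
      \<open>cadjoint B\<close>, its norm is controlled by pairing it with vectors
      \<open>cadjoint B z\<close> only, where \<open>inner_X\<close> and the majorization
      apply.\<close>
    show "norm (X x) \<le> norm x * C" for x
      using XM
    proof (rule inner_closure_range_bound)
      fix z
      have "inner (X x) (cadjoint B z) \<le> norm x * norm (cadjoint A z)"
        by (metis inner_X norm_cauchy_schwarz)
      also have "\<dots> \<le> norm x * (C * norm (cadjoint B z))"
        by (intro mult_left_mono majorized) auto
      finally show "inner (X x) (cadjoint B z) \<le> norm x * C * norm (cadjoint B z)"
        by (simp add: mult.assoc)
    qed (use C in simp)
  qed
  moreover have "X (c *\<^sub>C x) = c *\<^sub>C X x" for c x
    by (rule inj)
      (simp_all add: XM BX scaleC_closure_range bounded_clinear_cadjoint bounded_clinear_scaleC A B)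
  ultimately have "bounded_clinear X"
    by (simp add: bounded_clinear_def)
  then show ?thesis
    by (rule that) (use BX XM in auto)
qed

section \<open>The minus order\<close>

lemma inner_inverse_rel_imp_factor:
  fixes A B :: "'a::complex_hilbert_space \<Rightarrow> 'a"
  assumes A: "bounded_clinear A" and B: "bounded_clinear B"
    and S: "inner_inverse A D S" and rel: "inner_inverse_rel A B D S"
  obtains Q where "bounded_clinear Q" and "Q \<circ> Q = Q" and "cadjoint A = Q \<circ> cadjoint B"
proof -
  have AD: "A x \<in> D" and ASA: "A (S (A x)) = A x" for x
    using S unfolding inner_inverse_def by (blast, metis comp_apply)
  have SB: "S (B x) = S (A x)" and AS: "y \<in> D \<Longrightarrow> A (S y) = B (S y)" for x y
    using rel unfolding inner_inverse_rel_def by (metis comp_apply, blast)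
  have "range A \<subseteq> range B"
    by (metis AD AS ASA image_subsetI rangeI)
  then obtain X where X: "bounded_clinear X" and ABX: "A = B \<circ> X"
    and XM: "range X \<subseteq> closure (range (cadjoint B))"
    using douglas_factorization[OF A B] by blast
  have "S (A (X x)) = S (A x)" for x
    using SB[of "X x"] ABX by simp
  then have AX: "A (X x) = A x" for x
    by (metis ASA)
  \<comment> \<open>Under \<open>B\<close> the two sides become \<open>A (X x)\<close> and
    \<open>A x\<close>.\<close>
  have "X (X x) = X x" for x
    by (rule closure_range_cadjoint_inj[OF B])
      (use XM AX[of x] in \<open>auto simp: ABX\<close>)
  then have "X \<circ> X = X"
    by auto
  then show ?thesis
    using that[of "cadjoint X"] X B ABX
    by (metis bounded_clinear_cadjoint cadjoint_comp)
qed

text \<open>\<open>A = B \<circ> X\<close> makes \<open>B \<circ> T\<close> the identity on the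
  range of \<open>A\<close>, and \<open>A = P \<circ> B\<close> gives
  \<open>A \<circ> T \<circ> B = A\<close>.\<close>

lemma factor_imp_inner_inverse_rel:
  fixes A B :: "'a::complex_hilbert_space \<Rightarrow> 'a"
  assumes A: "bounded_clinear A" and B: "bounded_clinear B"
    and P: "P \<circ> P = P" and APB: "A = P \<circ> B" and ABX: "A = B \<circ> X"
  obtains S where "inner_inverse A UNIV S" and "inner_inverse_rel A B UNIV S"
proof -
  interpret vector_space_pair "scaleC :: complex \<Rightarrow> 'a \<Rightarrow> 'a" "scaleC :: complex \<Rightarrow> 'a \<Rightarrow> 'a"
    by (simp add: vector_space_pair_def vector_space_scaleC)
  have clin: "Vector_Spaces.linear scaleC scaleC T" if "bounded_clinear T" for T :: "'a \<Rightarrow> 'a"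
    using that unfolding Vector_Spaces.linear_iff bounded_clinear_def
    by (auto simp: vector_space_scaleC dest: bounded_linear.linear Real_Vector_Spaces.linear_add)
  \<comment> \<open>A purely algebraic, possibly discontinuous right inverse of \<open>B\<close> on
    its range, linear over the complex scalars.\<close>
  obtain T where T: "Vector_Spaces.linear scaleC scaleC T" and BTB: "\<And>x. B (T (B x)) = B x"
    using linear_exists_right_inverse_on[OF clin[OF B] vs1.subspace_UNIV] by auto
  have BTA: "B (T (A x)) = A x" for x
    by (simp add: ABX BTB)
  have ATB: "A (T (B x)) = A x" for x
    by (simp add: APB BTB)
  \<comment> \<open>\<open>A T A = P B T A = P A = P P B = A\<close>, where idempotence of
    \<open>P\<close> enters.\<close>
  have ATA: "A (T (A x)) = A x" for x
    using BTA P by (metis APB comp_apply)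
  \<comment> \<open>\<open>T\<close> alone need not satisfy \<open>T A = T B\<close>. With
    \<open>S = T A T\<close>, both \<open>S A\<close> and \<open>S B\<close> reduce to
    \<open>T A\<close>, and both \<open>A S\<close> and \<open>B S\<close> reduce to
    \<open>A T\<close>.\<close>
  have "Vector_Spaces.linear scaleC scaleC (T \<circ> A \<circ> T)"
    using T clin[OF A] by (intro Vector_Spaces.linear_compose)
  then have "clinear_on UNIV (T \<circ> A \<circ> T)"
    by (simp add: clinear_on_def Vector_Spaces.linear_iff)
  then show ?thesis
    using that[of "T \<circ> A \<circ> T"]
    by (simp add: inner_inverse_def inner_inverse_rel_def csubspace_def fun_eq_iff BTA ATB ATA)
qed

theorem corollary3p19:
  fixes A B :: "'a::complex_hilbert_space \<Rightarrow> 'a"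
  assumes "bounded_clinear A" and "bounded_clinear B"
  shows "minus_below A B \<longleftrightarrow>
    (\<exists>D S D' S'. inner_inverse A D S \<and> inner_inverse (cadjoint A) D' S' \<and>
      inner_inverse_rel A B D S \<and> inner_inverse_rel (cadjoint A) (cadjoint B) D' S')"
proof -
  note ad = assms[THEN bounded_clinear_cadjoint]
  note adad = assms[THEN cadjoint_cadjoint]
  show ?thesis
  proof
    assume "minus_below A B"
    then obtain P Q where P: "bounded_clinear P" "P \<circ> P = P" "A = P \<circ> B"
      and Q: "bounded_clinear Q" "Q \<circ> Q = Q" "cadjoint A = Q \<circ> cadjoint B"
      unfolding minus_below_def by blast
    \<comment> \<open>Taking adjoints in the equation for \<open>Q\<close> gives the right
      factorization of \<open>A\<close>; the equation for \<open>P\<close> likewise gives that of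
      \<open>cadjoint A\<close>.\<close>
    have "A = B \<circ> cadjoint Q"
      by (metis Q(1,3) ad(2) adad cadjoint_comp)
    moreover have "cadjoint A = cadjoint B \<circ> cadjoint P"
      using P assms(2) by (metis cadjoint_comp)
    ultimately show "\<exists>D S D' S'. inner_inverse A D S \<and> inner_inverse (cadjoint A) D' S' \<and>
      inner_inverse_rel A B D S \<and> inner_inverse_rel (cadjoint A) (cadjoint B) D' S'"
      using factor_imp_inner_inverse_rel[OF assms P(2,3)]
        factor_imp_inner_inverse_rel[OF ad Q(2,3)] by metis
  next
    assume "\<exists>D S D' S'. inner_inverse A D S \<and> inner_inverse (cadjoint A) D' S' \<and>
      inner_inverse_rel A B D S \<and> inner_inverse_rel (cadjoint A) (cadjoint B) D' S'"
    then obtain D S D' S' where "inner_inverse A D S" "inner_inverse_rel A B D S"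
      "inner_inverse (cadjoint A) D' S'" "inner_inverse_rel (cadjoint A) (cadjoint B) D' S'"
      by blast
    \<comment> \<open>The pair \<open>A\<close>, \<open>B\<close> yields \<open>Q\<close>; the pair
      of adjoints yields \<open>P\<close>, because taking adjoints twice returns \<open>A\<close>
      and \<open>B\<close>.\<close>
    then show "minus_below A B"
      using inner_inverse_rel_imp_factor[OF assms, of D S]
        inner_inverse_rel_imp_factor[OF ad, of D' S']
      unfolding minus_below_def adad by metis
  qed
qed

end
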